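(* For any function $s(n)=O(n^{1/2-\epsilon})$, where $0<\epsilon<\frac12$ is a constant, there is a family of unsatisfiable CNF formulas $\{F_n\}_{n=0}^\infty$, with $F_n$ having $\Theta(n)$ variables, such that $F_n$ has Monomial Calculus refutations of degree $O(s(n))$ but every Nullstellensatz refutation of $F_n$ has degree $\Omega(s(n)\log n)$.
   Context: A CNF formula is refuted via its polynomial encoding over a field $\mathbb F$: a clause $\bigvee_{x\in P}x\vee\bigvee_{y\in N}\bar y$ becomes $\prod_{x\in P}(1-x)\prod_{y\in N}y$, and Boolean axioms $x_i^2-x_i$ are available. Nullstellensatz (NS): a refutation of $p_1,\dots,p_m$ consists of polynomials $g_j,h_i$ with $\sum_j p_jg_j+\sum_i h_i(x_i^2-x_i)=1$; its degree is the maximum degree of the summands $p_jg_j$, $h_i(x_i^2-x_i)$. Monomial Calculus (MC): a refutation of a set $\mathcal P$ is a sequence of polynomials ending in $1$, each in $\mathcal P$, a Boolean axiom, or obtained from earlier ones by linear combination $\alpha p+\beta q$ ($\alpha,\beta\in\mathbb F$) or by multiplication $p\mapsto x_ip$ where $p$ is a monomial or the product of a monomial and an axiom. Degree of an MC refutation: maximum degree of its polynomials. *)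

theory Defs
  imports Complex_Main "HOL-Library.Poly_Mapping" "HOL-Library.Landau_Symbols"
begin

section \<open>Multivariate polynomials\<close>

text \<open>Variables are named by natural numbers; an exponent vector is an element of
  \<open>nat \<Rightarrow>\<^sub>0 nat\<close>, and the ring operations are those of \<open>Poly_Mapping\<close>.\<close>

type_synonym 'a mpoly = "(nat \<Rightarrow>\<^sub>0 nat) \<Rightarrow>\<^sub>0 'a"

definition mp_monom :: "(nat \<Rightarrow>\<^sub>0 nat) \<Rightarrow> 'a::comm_ring_1 mpoly" where
  "mp_monom m = Poly_Mapping.single m 1"

definition mp_var :: "nat \<Rightarrow> 'a::comm_ring_1 mpoly" where
  "mp_var i = mp_monom (Poly_Mapping.single i 1)"

definition mp_const :: "'a \<Rightarrow> 'a::comm_ring_1 mpoly" where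
  "mp_const c = Poly_Mapping.single 0 c"

text \<open>The zero polynomial gets degree 0.\<close>

definition total_degree :: "'a::zero mpoly \<Rightarrow> nat" where
  "total_degree p =
     Max (insert 0 ((\<lambda>m. \<Sum>i\<in>Poly_Mapping.keys m. Poly_Mapping.lookup m i) ` Poly_Mapping.keys p))"

definition polys_over :: "nat set \<Rightarrow> 'a::zero mpoly set" where
  "polys_over V = {p. \<forall>m\<in>Poly_Mapping.keys p. Poly_Mapping.keys m \<subseteq> V}"

section \<open>CNF formulas and their polynomial encoding\<close>

text \<open>The pair \<open>(P, N)\<close> is the clause with positive literals \<open>x\<close> for \<open>x \<in> P\<close> and
  negated literals for \<open>y \<in> N\<close>; finiteness is part of \<open>is_cnf\<close>.\<close>

type_synonym clause = "nat set \<times> nat set"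
type_synonym cnf = "clause set"

definition is_cnf :: "cnf \<Rightarrow> bool" where
  "is_cnf F \<longleftrightarrow> finite F \<and> (\<forall>(P, N)\<in>F. finite P \<and> finite N)"

definition cnf_vars :: "cnf \<Rightarrow> nat set" where
  "cnf_vars F = (\<Union>(P, N)\<in>F. P \<union> N)"

definition satisfies_clause :: "(nat \<Rightarrow> bool) \<Rightarrow> clause \<Rightarrow> bool" where
  "satisfies_clause \<alpha> = (\<lambda>(P, N). (\<exists>x\<in>P. \<alpha> x) \<or> (\<exists>y\<in>N. \<not> \<alpha> y))"

definition unsatisfiable :: "cnf \<Rightarrow> bool" where
  "unsatisfiable F \<longleftrightarrow> (\<nexists>\<alpha>. \<forall>C\<in>F. satisfies_clause \<alpha> C)"

definition clause_poly :: "clause \<Rightarrow> 'a::comm_ring_1 mpoly" where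
  "clause_poly = (\<lambda>(P, N). (\<Prod>x\<in>P. 1 - mp_var x) * (\<Prod>y\<in>N. mp_var y))"

definition cnf_polys :: "cnf \<Rightarrow> 'a::comm_ring_1 mpoly set" where
  "cnf_polys F = clause_poly ` F"

definition bool_axiom :: "nat \<Rightarrow> 'a::comm_ring_1 mpoly" where
  "bool_axiom i = mp_var i ^ 2 - mp_var i"

section \<open>Nullstellensatz\<close>

text \<open>In both proof systems \<open>V\<close> is the (finite) set of variables of the ambient polynomial
  ring and \<open>A\<close> is the (finite) set of polynomials to be refuted.\<close>

definition ns_refutation ::
  "nat set \<Rightarrow> 'a::field mpoly set \<Rightarrow> ('a mpoly \<Rightarrow> 'a mpoly) \<Rightarrow> (nat \<Rightarrow> 'a mpoly) \<Rightarrow> bool" where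
  "ns_refutation V A g h \<longleftrightarrow>
     (\<forall>p\<in>A. g p \<in> polys_over V) \<and> (\<forall>i\<in>V. h i \<in> polys_over V) \<and>
     (\<Sum>p\<in>A. p * g p) + (\<Sum>i\<in>V. h i * bool_axiom i) = 1"

definition ns_degree ::
  "nat set \<Rightarrow> 'a::field mpoly set \<Rightarrow> ('a mpoly \<Rightarrow> 'a mpoly) \<Rightarrow> (nat \<Rightarrow> 'a mpoly) \<Rightarrow> nat" where
  "ns_degree V A g h =
     Max ((\<lambda>p. total_degree (p * g p)) ` A \<union> (\<lambda>i. total_degree (h i * bool_axiom i)) ` V)"

section \<open>Monomial Calculus\<close>

text \<open>Multiplication by a variable is allowed only on monomials and on products of a monomial
  with an axiom, where the axioms comprise \<open>A\<close> and the Boolean axioms.\<close>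

definition mc_multipliable :: "nat set \<Rightarrow> 'a::field mpoly set \<Rightarrow> 'a mpoly \<Rightarrow> bool" where
  "mc_multipliable V A p \<longleftrightarrow>
     (\<exists>m. p = mp_monom m) \<or> (\<exists>m. \<exists>q \<in> A \<union> bool_axiom ` V. p = mp_monom m * q)"

definition mc_refutation :: "nat set \<Rightarrow> 'a::field mpoly set \<Rightarrow> 'a mpoly list \<Rightarrow> bool" where
  "mc_refutation V A \<pi> \<longleftrightarrow> \<pi> \<noteq> [] \<and> last \<pi> = 1 \<and>
     (\<forall>k<length \<pi>.
        \<pi> ! k \<in> A \<or>
        \<pi> ! k \<in> bool_axiom ` V \<or>
        (\<exists>i<k. \<exists>j<k. \<exists>\<alpha> \<beta>. \<pi> ! k = mp_const \<alpha> * \<pi> ! i + mp_const \<beta> * \<pi> ! j) \<or>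
        (\<exists>j<k. \<exists>i\<in>V. mc_multipliable V A (\<pi> ! j) \<and> \<pi> ! k = mp_var i * \<pi> ! j))"

definition mc_degree :: "'a::field mpoly list \<Rightarrow> nat" where
  "mc_degree \<pi> = Max (total_degree ` set \<pi>)"

end

theory Submission
  imports Defs
begin

text \<open>Take \<open>L = n div s\<close> blocks of \<open>s\<close> variables each. The formula says that the
  first block is true, that a fully true block implies every variable of the next one, and that the
  last block is not fully true. Monomial Calculus derives the product of each block from the product
  of the next one, holding two blocks at a time. For the lower bound, map a monomial to the set of
  blocks which it contains completely: multiplying by an axiom then amounts to moves of the
  reversible pebble game on a path with \<open>L\<close> vertices, and degree below \<open>s * (k + 1)\<close>
  allows at most \<open>k\<close> pebbles. The indicator of the positions reachable with \<open>k\<close> pebbles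
  is therefore a dual solution as long as the end of the path is out of reach, that is, for
  \<open>2 ^ k \<le> L\<close>. Since \<open>s\<close> is at most the square root of \<open>n\<close>, such
  \<open>k\<close> are of order \<open>ln n\<close>.\<close>

section \<open>Monomials and degrees\<close>

definition mdeg :: "(nat \<Rightarrow>\<^sub>0 nat) \<Rightarrow> nat" where
  "mdeg m = (\<Sum>i\<in>Poly_Mapping.keys m. Poly_Mapping.lookup m i)"

lemma keys_plus_nat:
  "Poly_Mapping.keys (m + m') = Poly_Mapping.keys m \<union> Poly_Mapping.keys (m' :: 'a \<Rightarrow>\<^sub>0 nat)"
  by (auto simp: in_keys_iff lookup_add)

lemma mdeg_superset:
  assumes "finite A" "Poly_Mapping.keys m \<subseteq> A"
  shows "mdeg m = (\<Sum>i\<in>A. Poly_Mapping.lookup m i)"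
  unfolding mdeg_def using assms by (intro sum.mono_neutral_left) (auto simp: in_keys_iff)

lemma mdeg_plus [simp]: "mdeg (m + m') = mdeg m + mdeg m'"
  by (simp add: mdeg_superset[of "Poly_Mapping.keys m \<union> Poly_Mapping.keys m'"] keys_plus_nat
      lookup_add sum.distrib)

lemma mdeg_0 [simp]: "mdeg 0 = 0"
  by (simp add: mdeg_def)

lemma mdeg_single [simp]: "mdeg (Poly_Mapping.single i c) = c"
  by (simp add: mdeg_def)

lemma card_keys_le_mdeg: "card (Poly_Mapping.keys m) \<le> mdeg m"
proof -
  have "card (Poly_Mapping.keys m) = (\<Sum>i\<in>Poly_Mapping.keys m. 1)" by simp
  also have "\<dots> \<le> mdeg m"
    unfolding mdeg_def by (intro sum_mono) (auto simp: in_keys_iff)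
  finally show ?thesis .
qed

lemma total_degree_le_iff: "total_degree p \<le> D \<longleftrightarrow> (\<forall>m\<in>Poly_Mapping.keys p. mdeg m \<le> D)"
  by (simp add: total_degree_def mdeg_def)

lemma total_degree_1 [simp]: "total_degree (1 :: 'a::comm_ring_1 mpoly) = 0"
  using total_degree_le_iff[of "1 :: 'a mpoly" 0] by simp

lemma total_degree_monom_le: "mdeg m \<le> D \<Longrightarrow> total_degree (mp_monom m :: 'a::comm_ring_1 mpoly) \<le> D"
  by (simp add: total_degree_le_iff mp_monom_def)

lemma total_degree_diff_le:
  fixes p q :: "'a::comm_ring_1 mpoly"
  assumes "total_degree p \<le> D" "total_degree q \<le> D"
  shows "total_degree (p - q) \<le> D"
proof -
  have "Poly_Mapping.keys (p - q) \<subseteq> Poly_Mapping.keys p \<union> Poly_Mapping.keys q"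
    by (auto simp: in_keys_iff lookup_minus)
  then show ?thesis using assms unfolding total_degree_le_iff by blast
qed

lemma total_degree_lincomb_le:
  fixes p q :: "'a::comm_ring_1 mpoly"
  assumes "total_degree p \<le> D" "total_degree q \<le> D"
  shows "total_degree (mp_const a * p + mp_const b * q) \<le> D"
proof -
  have *: "Poly_Mapping.keys (mp_const c * r) \<subseteq> Poly_Mapping.keys r" for c and r :: "'a mpoly"
    using keys_mult[of "mp_const c" r] by (auto simp: mp_const_def split: if_splits)
  show ?thesis using assms *[of a p] *[of b q] keys_add[of "mp_const a * p" "mp_const b * q"]
    unfolding total_degree_le_iff by blast
qed

lemma mp_monom_mult: "mp_monom m * mp_monom m' = (mp_monom (m + m') :: 'a::comm_ring_1 mpoly)"
  by (simp add: mp_monom_def mult_single)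

lemma mp_monom_0 [simp]: "mp_monom 0 = (1 :: 'a::comm_ring_1 mpoly)"
  by (simp add: mp_monom_def)

lemma poly_mapping_expand:
  "p = (\<Sum>m\<in>Poly_Mapping.keys p. Poly_Mapping.single m (Poly_Mapping.lookup p m))"
proof (rule poly_mapping_eqI)
  fix k
  show "Poly_Mapping.lookup p k =
      Poly_Mapping.lookup (\<Sum>m\<in>Poly_Mapping.keys p. Poly_Mapping.single m (Poly_Mapping.lookup p m)) k"
    by (simp add: lookup_sum lookup_single when_def in_keys_iff)
qed

lemma mp_monom_mult_expand:
  fixes p :: "'a::comm_ring_1 mpoly"
  shows "mp_monom a * p =
    (\<Sum>m\<in>Poly_Mapping.keys p. Poly_Mapping.single (a + m) (Poly_Mapping.lookup p m))"
proof -
  have "mp_monom a * p =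
      mp_monom a * (\<Sum>m\<in>Poly_Mapping.keys p. Poly_Mapping.single m (Poly_Mapping.lookup p m))"
    using poly_mapping_expand[of p] by simp
  then show ?thesis by (simp add: sum_distrib_left mp_monom_def mult_single)
qed

lemma lookup_mp_monom_mult [simp]:
  fixes p :: "'a::comm_ring_1 mpoly"
  shows "Poly_Mapping.lookup (mp_monom a * p) (a + m) = Poly_Mapping.lookup p m"
  by (simp add: mp_monom_mult_expand lookup_sum lookup_single when_def in_keys_iff)

text \<open>At a monomial of maximal degree in \<open>g\<close>, the contribution of \<open>X * y * g\<close> cannot be
  cancelled by \<open>X * g\<close>.\<close>

lemma mdeg_le_of_total_degree_mult_binomial:
  fixes g :: "'a::comm_ring_1 mpoly"
  assumes "total_degree (mp_monom X * (1 - mp_var y) * g) \<le> D" "m \<in> Poly_Mapping.keys g"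
  shows "mdeg (X + Poly_Mapping.single y 1 + m) \<le> D"
proof -
  obtain m0 where m0: "m0 \<in> Poly_Mapping.keys g"
    and max: "\<And>m'. m' \<in> Poly_Mapping.keys g \<Longrightarrow> mdeg m' \<le> mdeg m0"
  proof -
    let ?M = "mdeg ` Poly_Mapping.keys g"
    have "Max ?M \<in> ?M" using assms(2) by (intro Max_in) auto
    then obtain m0 where "m0 \<in> Poly_Mapping.keys g" "Max ?M = mdeg m0" by blast
    then show thesis using Max_ge[of ?M] by (intro that[of m0]) auto
  qed
  let ?y = "Poly_Mapping.single y 1 :: nat \<Rightarrow>\<^sub>0 nat"
  have "Poly_Mapping.lookup (mp_monom X * g) (X + (?y + m0)) = 0"
    using max[of "?y + m0"] by (auto simp: in_keys_iff simp del: One_nat_def)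
  moreover have "Poly_Mapping.lookup (mp_monom (X + ?y) * g) (X + (?y + m0)) = Poly_Mapping.lookup g m0"
    unfolding add.assoc[symmetric] by (rule lookup_mp_monom_mult)
  moreover have "mp_monom X * (1 - mp_var y) * g = mp_monom X * g - mp_monom (X + ?y) * g"
    by (simp add: mp_var_def algebra_simps flip: mp_monom_mult)
  ultimately have "X + (?y + m0) \<in> Poly_Mapping.keys (mp_monom X * (1 - mp_var y) * g)"
    using m0 by (simp add: in_keys_iff lookup_minus)
  then have "mdeg (X + (?y + m0)) \<le> D"
    using assms(1) total_degree_le_iff by blast
  with max[OF assms(2)] show ?thesis by simp
qed

section \<open>Linear functionals on polynomials\<close>

definition lin_ext :: "((nat \<Rightarrow>\<^sub>0 nat) \<Rightarrow> 'a) \<Rightarrow> 'a::comm_ring_1 mpoly \<Rightarrow> 'a" where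
  "lin_ext E p = (\<Sum>m\<in>Poly_Mapping.keys p. Poly_Mapping.lookup p m * E m)"

lemma lin_ext_superset:
  assumes "finite A" "Poly_Mapping.keys p \<subseteq> A"
  shows "lin_ext E p = (\<Sum>m\<in>A. Poly_Mapping.lookup p m * E m)"
  unfolding lin_ext_def using assms by (intro sum.mono_neutral_left) (auto simp: in_keys_iff)

lemma lin_ext_add: "lin_ext E (p + q) = lin_ext E p + lin_ext E q"
  by (simp add: lin_ext_superset[of "Poly_Mapping.keys p \<union> Poly_Mapping.keys q"] keys_add
      lookup_add sum.distrib algebra_simps)

lemma lin_ext_0 [simp]: "lin_ext E 0 = 0"
  by (simp add: lin_ext_def)

lemma lin_ext_uminus: "lin_ext E (- p) = - lin_ext E p"
  using lin_ext_add[of E p "- p"] by (simp add: eq_neg_iff_add_eq_0 add.commute)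

lemma lin_ext_diff: "lin_ext E (p - q) = lin_ext E p - lin_ext E q"
  using lin_ext_add[of E p "- q"] by (simp add: lin_ext_uminus)

lemma lin_ext_sum: "lin_ext E (\<Sum>i\<in>I. f i) = (\<Sum>i\<in>I. lin_ext E (f i))"
  by (induction I rule: infinite_finite_induct) (simp_all add: lin_ext_add)

lemma lin_ext_single [simp]: "lin_ext E (Poly_Mapping.single m c) = c * E m"
  by (simp add: lin_ext_def)

lemma lin_ext_1 [simp]: "lin_ext E 1 = E 0"
  by (simp add: lin_ext_def)

lemma lin_ext_monom_mult: "lin_ext E (mp_monom a * p) = lin_ext (\<lambda>m. E (a + m)) p"
  by (simp add: mp_monom_mult_expand lin_ext_sum) (simp add: lin_ext_def)

lemma lin_ext_cong:
  "(\<And>m. m \<in> Poly_Mapping.keys p \<Longrightarrow> E m = E' m) \<Longrightarrow> lin_ext E p = lin_ext E' p"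
  by (simp add: lin_ext_def)

text \<open>Initial clauses, implications and, up to sign, Boolean axioms all have the shape X * (1
  - y). The functional sees such a multiple as a difference of two shifts of \<open>g\<close>. The
  top part of \<open>g\<close> cannot cancel, so every monomial compared has degree at most
  \<open>D\<close>, and invariance of \<open>E\<close> up to that degree suffices.\<close>

lemma lin_ext_binomial_mult:
  fixes g :: "'a::comm_ring_1 mpoly"
  assumes "total_degree (mp_monom X * (1 - mp_var y) * g) \<le> D"
    and "\<And>m. mdeg (X + m + Poly_Mapping.single y 1) \<le> D \<Longrightarrow> E (X + m + Poly_Mapping.single y 1) = E (X + m)"
  shows "lin_ext E (mp_monom X * (1 - mp_var y) * g) = 0"
proof -
  let ?y = "Poly_Mapping.single y 1 :: nat \<Rightarrow>\<^sub>0 nat"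
  have "mp_monom X * (1 - mp_var y) * g = mp_monom X * g - mp_monom (X + ?y) * g"
    by (simp add: mp_var_def algebra_simps flip: mp_monom_mult)
  moreover have "lin_ext (\<lambda>m. E (X + ?y + m)) g = lin_ext (\<lambda>m. E (X + m)) g"
  proof (rule lin_ext_cong)
    fix m assume "m \<in> Poly_Mapping.keys g"
    then have "mdeg (X + ?y + m) \<le> D"
      by (rule mdeg_le_of_total_degree_mult_binomial[OF assms(1)])
    then show "E (X + ?y + m) = E (X + m)"
      using assms(2)[of m] by (simp add: ac_simps)
  qed
  ultimately show ?thesis by (simp add: lin_ext_diff lin_ext_monom_mult)
qed

section \<open>Reversible pebbling of a path\<close>

definition can_move :: "nat set \<Rightarrow> nat \<Rightarrow> bool" where
  "can_move S x \<longleftrightarrow> x = 0 \<or> x - 1 \<in> S"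

text \<open>Both moves obey the same condition on \<open>S\<close>, which makes the game reversible;
  the pebble bound is tested on placement only, as removal cannot raise the count.\<close>

inductive reach :: "nat \<Rightarrow> nat set \<Rightarrow> bool" for k where
  empty: "reach k {}"
| place: "reach k S \<Longrightarrow> can_move S x \<Longrightarrow> card (insert x S) \<le> k \<Longrightarrow> reach k (insert x S)"
| remove: "reach k (insert x S) \<Longrightarrow> can_move S x \<Longrightarrow> reach k S"

lemma reach_finite_card: "reach k S \<Longrightarrow> finite S \<and> card S \<le> k"
  by (induction rule: reach.induct) (auto simp: card_insert_if split: if_splits)

lemma reach_insert_iff:
  "can_move S x \<Longrightarrow> card (insert x S) \<le> k \<Longrightarrow> reach k (insert x S) \<longleftrightarrow> reach k S"
  by (blast intro: reach.place reach.remove)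

text \<open>Cut the path at \<open>2 ^ k\<close>. A pebble enters the upper half only from a lower half occupying
  \<open>2 ^ k - 1\<close>, which \<open>k\<close> pebbles cannot reach. While the upper half is occupied, the
  lower half is played with at most \<open>k\<close> pebbles, so by reversibility it is never emptied; hence
  the upper half is played with at most \<open>k\<close> pebbles as well.\<close>

lemma reach_less_power2: "reach k S \<Longrightarrow> x \<in> S \<Longrightarrow> Suc x < 2 ^ k"
proof (induction k arbitrary: S x)
  case 0
  then show ?case using reach_finite_card[of 0 S] by auto
next
  case (Suc k)
  define lo where "lo S = {x \<in> S. x < 2 ^ k}" for S :: "nat set"
  define hi where "hi S = {x. x + 2 ^ k \<in> S}" for S :: "nat set"
  define inv where "inv S \<longleftrightarrow> hi S = {} \<or> \<not> reach k (lo S) \<and> reach k (hi S)" for S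
  have hi_card: "card S = card (lo S) + card (hi S)" and hi_fin: "finite (hi S)" and lo_fin: "finite (lo S)"
    if "finite S" for S
  proof -
    have S: "S = lo S \<union> (\<lambda>x. x + 2 ^ k) ` hi S"
    proof (intro equalityI subsetI)
      fix x assume "x \<in> S"
      show "x \<in> lo S \<union> (\<lambda>x. x + 2 ^ k) ` hi S"
      proof (cases "x < 2 ^ k")
        case True then show ?thesis using \<open>x \<in> S\<close> by (simp add: lo_def)
      next
        case False
        then have "x = (x - 2 ^ k) + 2 ^ k" by simp
        moreover from this have "x - 2 ^ k \<in> hi S" using \<open>x \<in> S\<close> by (simp add: hi_def)
        ultimately show ?thesis by blast
      qed
    qed (auto simp: lo_def hi_def)
    have inj: "inj_on (\<lambda>x::nat. x + 2 ^ k) A" for A by (simp add: inj_on_def)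
    have "finite ((\<lambda>x. x + 2 ^ k) ` hi S)" using that S by (metis finite_Un)
    then show f: "finite (hi S)" using inj finite_imageD by blast
    show l: "finite (lo S)" using that by (simp add: lo_def)
    have "lo S \<inter> (\<lambda>x. x + 2 ^ k) ` hi S = {}" by (auto simp: lo_def)
    then have "card (lo S \<union> (\<lambda>x. x + 2 ^ k) ` hi S) = card (lo S) + card (hi S)"
      using f l by (simp add: card_Un_disjoint card_image[OF inj])
    then show "card S = card (lo S) + card (hi S)" using S by simp
  qed
  \<comment> \<open>Placing and removing a pebble are the two directions of this equivalence, so one
    argument covers both.\<close>
  have step: "inv (insert x S) \<longleftrightarrow> inv S"
    if fin: "finite S" and mv: "can_move S x" and card: "card (insert x S) \<le> Suc k" and x: "x \<notin> S" for x S
  proof (cases "x < 2 ^ k")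
    case True
    have hi: "hi (insert x S) = hi S" using True by (auto simp: hi_def)
    have lo: "lo (insert x S) = insert x (lo S)" using True by (auto simp: lo_def)
    show ?thesis
    proof (cases "hi S = {}")
      case False
      then have "card (hi S) > 0" using hi_fin[OF fin] by (simp add: card_gt_0_iff)
      then have "card (insert x (lo S)) \<le> k"
        using hi_card[of "insert x S"] card fin hi lo by simp
      moreover have "can_move (lo S) x" using mv True by (auto simp: can_move_def lo_def)
      ultimately show ?thesis by (simp add: inv_def hi lo reach_insert_iff)
    qed (simp add: inv_def hi)
  next
    case False
    define y where "y = x - 2 ^ k"
    have xy: "x = y + 2 ^ k" using False by (simp add: y_def)
    have hi: "hi (insert x S) = insert y (hi S)" using xy by (auto simp: hi_def)
    have lo: "lo (insert x S) = lo S" using False by (auto simp: lo_def)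
    \<comment> \<open>An unreachable lower half is nonempty, since the empty set is reachable. It
      therefore holds a pebble, which leaves at most \<open>k\<close> for the upper half.\<close>
    have key: "reach k (insert y (hi S)) \<longleftrightarrow> reach k (hi S)" if "\<not> reach k (lo S)"
    proof (rule reach_insert_iff)
      have "lo S \<noteq> {}" using that reach.empty by metis
      then have "card (lo S) > 0" using lo_fin[OF fin] by (simp add: card_gt_0_iff)
      then show "card (insert y (hi S)) \<le> k"
        using hi_card[of "insert x S"] card fin hi lo by simp
      show "can_move (hi S) y" using mv xy by (cases y) (auto simp: can_move_def hi_def)
    qed
    show ?thesis
    proof (cases "hi S = {}")
      case True
      \<comment> \<open>The first pebble of the upper half must stand on \<open>2 ^ k\<close>, hence
        \<open>2 ^ k - 1\<close> is occupied. By the induction hypothesis such a lower half is out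
        of reach for \<open>k\<close> pebbles.\<close>
      have "y = 0"
        using mv xy True by (cases y) (auto simp: can_move_def hi_def)
      then have "2 ^ k - 1 \<in> lo S" using mv xy by (auto simp: can_move_def lo_def)
      then have "\<not> reach k (lo S)" using Suc.IH[of "lo S" "2 ^ k - 1"] by auto
      then show ?thesis using key True reach.empty by (simp add: inv_def hi lo)
    next
      case False
      then show ?thesis using key by (auto simp: inv_def hi lo)
    qed
  qed
  have "reach (Suc k) S \<Longrightarrow> inv S" for S
  proof (induction rule: reach.induct)
    case empty
    then show ?case by (simp add: inv_def hi_def)
  next
    case (place S x)
    then show ?case using step[of S x] reach_finite_card by (cases "x \<in> S") (auto simp: insert_absorb)
  next
    case (remove x S)
    then show ?case using step[of S x] reach_finite_card[OF remove.hyps(1)]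
      by (cases "x \<in> S") (auto simp: insert_absorb)
  qed
  then have inv: "inv S" using Suc.prems by blast
  show ?case
  proof (cases "x < 2 ^ k")
    case False
    then have "x - 2 ^ k \<in> hi S" using Suc.prems by (simp add: hi_def)
    then have "Suc (x - 2 ^ k) < 2 ^ k" using inv Suc.IH by (auto simp: inv_def)
    then show ?thesis by simp
  next
    case True
    have "(0::nat) < 2 ^ k" by simp
    with True show ?thesis by (simp only: power_Suc)
  qed
qed


section \<open>The blown-up path formula\<close>

definition block :: "nat \<Rightarrow> nat \<Rightarrow> nat set" where
  "block s t = {t * s..<t * s + s}"

lemma finite_block [simp]: "finite (block s t)" and card_block [simp]: "card (block s t) = s"
  by (simp_all add: block_def)

lemma mem_block_iff: "s > 0 \<Longrightarrow> y \<in> block s t \<longleftrightarrow> y div s = t"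
  by (auto simp: block_def dividend_less_times_div algebra_simps
      intro: div_nat_eqI)

text \<open>Each implied variable gets its own clause, so that every clause polynomial except that
  of the closing clause is a monomial times a single factor \<open>1 - mp_var y\<close>.\<close>

definition block_cnf :: "nat \<Rightarrow> nat \<Rightarrow> cnf" where
  "block_cnf s L = (\<lambda>y. ({y}, {})) ` block s 0
     \<union> (\<Union>t\<in>{t. Suc t < L}. (\<lambda>y. ({y}, block s t)) ` block s (Suc t))
     \<union> {({}, block s (L - 1))}"

lemma is_cnf_block_cnf: "is_cnf (block_cnf s L)"
proof -
  have "finite {t. Suc t < L}" by (rule finite_subset[of _ "{..<L}"]) auto
  then show ?thesis by (auto simp: is_cnf_def block_cnf_def)
qed

lemma cnf_vars_block_cnf:
  assumes "s > 0" "L > 0"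
  shows "cnf_vars (block_cnf s L) = {..<s * L}"
proof -
  have "cnf_vars (block_cnf s L) = (\<Union>t<L. block s t)"
  proof (intro equalityI subsetI)
    fix y assume "y \<in> (\<Union>t<L. block s t)"
    then obtain t where t: "t < L" "y \<in> block s t" by blast
    then show "y \<in> cnf_vars (block_cnf s L)"
      by (cases t) (auto simp: cnf_vars_def block_cnf_def)
  next
    fix y assume "y \<in> cnf_vars (block_cnf s L)"
    then consider "y \<in> block s 0" | t where "Suc t < L" "y \<in> block s t \<or> y \<in> block s (Suc t)"
      | "y \<in> block s (L - 1)"
      by (auto simp: cnf_vars_def block_cnf_def)
    then show "y \<in> (\<Union>t<L. block s t)"
      using assms(2) by cases (auto intro: Suc_lessD)
  qed
  also have "\<dots> = {..<s * L}"
    using assms by (auto simp: mem_block_iff div_less_iff_less_mult mult.commute)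
  finally show ?thesis .
qed

lemma unsatisfiable_block_cnf: "unsatisfiable (block_cnf s L)"
  unfolding unsatisfiable_def
proof
  assume "\<exists>\<alpha>. \<forall>C\<in>block_cnf s L. satisfies_clause \<alpha> C"
  then obtain \<alpha> where \<alpha>: "\<And>C. C \<in> block_cnf s L \<Longrightarrow> satisfies_clause \<alpha> C" by blast
  have "t \<le> L - 1 \<Longrightarrow> \<forall>y\<in>block s t. \<alpha> y" for t
  proof (induction t)
    case 0
    show ?case
    proof
      fix y assume "y \<in> block s 0"
      then have "({y}, {}) \<in> block_cnf s L" by (simp add: block_cnf_def)
      then show "\<alpha> y" using \<alpha> by (fastforce simp: satisfies_clause_def)
    qed
  next
    case (Suc t)
    show ?case
    proof
      fix y assume "y \<in> block s (Suc t)"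
      then have "({y}, block s t) \<in> block_cnf s L"
        using Suc.prems unfolding block_cnf_def by (intro UnI1 UnI2 UN_I[of t] imageI) auto
      then show "\<alpha> y" using \<alpha> Suc by (fastforce simp: satisfies_clause_def)
    qed
  qed
  moreover have "satisfies_clause \<alpha> ({}, block s (L - 1))"
    by (rule \<alpha>) (simp add: block_cnf_def)
  ultimately show False by (auto simp: satisfies_clause_def)
qed

section \<open>Square-free monomials and the encoded clauses\<close>

definition ind :: "nat set \<Rightarrow> (nat \<Rightarrow>\<^sub>0 nat)" where
  "ind B = (\<Sum>i\<in>B. Poly_Mapping.single i 1)"

lemma ind_empty [simp]: "ind {} = 0"
  by (simp add: ind_def)

lemma ind_insert: "finite B \<Longrightarrow> y \<notin> B \<Longrightarrow> ind (insert y B) = Poly_Mapping.single y 1 + ind B"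
  by (simp add: ind_def)

lemma ind_Un: "finite B \<Longrightarrow> finite C \<Longrightarrow> B \<inter> C = {} \<Longrightarrow> ind (B \<union> C) = ind B + ind C"
  by (simp add: ind_def sum.union_disjoint)

lemma keys_ind: "finite B \<Longrightarrow> Poly_Mapping.keys (ind B) = B"
  by (induction B rule: finite_induct) (auto simp: ind_insert keys_plus_nat)

lemma mdeg_ind: "finite B \<Longrightarrow> mdeg (ind B) = card B"
  by (induction B rule: finite_induct) (auto simp: ind_insert)

lemma prod_mp_var: "finite B \<Longrightarrow> (\<Prod>y\<in>B. mp_var y) = (mp_monom (ind B) :: 'a::comm_ring_1 mpoly)"
  by (induction B rule: finite_induct) (simp_all add: ind_insert mp_var_def mp_monom_mult)

lemma clause_poly_singleton:
  "finite B \<Longrightarrow> clause_poly ({y}, B) = (mp_monom (ind B) * (1 - mp_var y) :: 'a::comm_ring_1 mpoly)"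
  by (simp add: clause_poly_def prod_mp_var mult.commute)

lemma clause_poly_neg:
  "finite B \<Longrightarrow> clause_poly ({}, B) = (mp_monom (ind B) :: 'a::comm_ring_1 mpoly)"
  by (simp add: clause_poly_def prod_mp_var)

lemma cnf_polys_block_cnf:
  "(cnf_polys (block_cnf s L) :: 'a::comm_ring_1 mpoly set) =
     (\<lambda>y. 1 - mp_var y) ` block s 0
     \<union> (\<Union>t\<in>{t. Suc t < L}. (\<lambda>y. mp_monom (ind (block s t)) * (1 - mp_var y)) ` block s (Suc t))
     \<union> {mp_monom (ind (block s (L - 1)))}"
  by (simp add: cnf_polys_def block_cnf_def image_Un image_UN image_image clause_poly_singleton
      clause_poly_neg)

section \<open>The Nullstellensatz lower bound\<close>

definition full :: "nat \<Rightarrow> (nat \<Rightarrow>\<^sub>0 nat) \<Rightarrow> nat set" where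
  "full s m = {t. block s t \<subseteq> Poly_Mapping.keys m}"

lemma finite_full:
  assumes "s > 0"
  shows "finite (full s m)"
proof (rule finite_subset)
  show "full s m \<subseteq> (\<lambda>y. y div s) ` Poly_Mapping.keys m"
  proof
    fix t assume "t \<in> full s m"
    moreover have "t * s \<in> block s t" using assms by (simp add: block_def)
    ultimately have "t * s \<in> Poly_Mapping.keys m" by (auto simp: full_def)
    moreover have "t = t * s div s" using assms by simp
    ultimately show "t \<in> (\<lambda>y. y div s) ` Poly_Mapping.keys m" by blast
  qed
qed simp

text \<open>Blocks are disjoint and each full one contributes \<open>s\<close> distinct variables.
  This turns a degree bound into a pebble bound.\<close>

lemma card_full_le_mdeg:
  assumes "s > 0"
  shows "s * card (full s m) \<le> mdeg m"
proof -
  have "card (\<Union>t\<in>full s m. block s t) = (\<Sum>t\<in>full s m. card (block s t))"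
    using assms finite_full by (intro card_UN_disjoint) (auto simp: mem_block_iff)
  then have "s * card (full s m) = card (\<Union>t\<in>full s m. block s t)" by simp
  also have "\<dots> \<le> card (Poly_Mapping.keys m)" by (intro card_mono) (auto simp: full_def)
  also note card_keys_le_mdeg
  finally show ?thesis .
qed

lemma full_plus_single:
  assumes "s > 0"
  shows "full s (m + Poly_Mapping.single y 1) = full s m
    \<or> full s (m + Poly_Mapping.single y 1) = insert (y div s) (full s m)"
  using assms by (auto simp: full_def keys_plus_nat mem_block_iff subset_iff)

text \<open>The dual solution: a monomial is read as the set of its full blocks, and gets value 1
  exactly if \<open>k\<close> pebbles reach this set.\<close>

definition dual_val :: "nat \<Rightarrow> nat \<Rightarrow> (nat \<Rightarrow>\<^sub>0 nat) \<Rightarrow> 'a::comm_ring_1" where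
  "dual_val s k m = (if reach k (full s m) then 1 else 0)"

text \<open>The degree bound leaves at most \<open>k\<close> full blocks. The new variable thus
  either completes no block or performs a legal move of the game, and legal moves preserve
  reachability in both directions.\<close>

lemma dual_val_plus_single:
  assumes "s > 0" "can_move (full s m) (y div s)"
    and "mdeg (m + Poly_Mapping.single y 1) < s * Suc k"
  shows "dual_val s k (m + Poly_Mapping.single y 1) = dual_val s k m"
proof -
  let ?m = "m + Poly_Mapping.single y 1"
  have "s * card (full s ?m) < s * Suc k"
    using card_full_le_mdeg[OF assms(1), of ?m] assms(3) by linarith
  then have "card (full s ?m) \<le> k" by (simp only: mult_less_cancel1 less_Suc_eq_le)
  then show ?thesis
    using full_plus_single[OF assms(1), of m y] reach_insert_iff[OF assms(2), of k]
    by (auto simp: dual_val_def)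
qed

text \<open>In a refutation of smaller degree the dual functional would vanish on every summand, yet
  it maps their sum 1 to the value of the empty pebble set, which is 1.\<close>

lemma ns_degree_block_cnf:
  fixes g :: "'a::field mpoly \<Rightarrow> 'a mpoly"
  assumes s: "s > 0" and L: "2 ^ k \<le> L"
    and ref: "ns_refutation (cnf_vars (block_cnf s L)) (cnf_polys (block_cnf s L)) g h"
  shows "s * Suc k \<le> ns_degree (cnf_vars (block_cnf s L)) (cnf_polys (block_cnf s L)) g h"
proof (rule ccontr)
  let ?V = "cnf_vars (block_cnf s L)"
  let ?A = "cnf_polys (block_cnf s L) :: 'a mpoly set"
  let ?D = "ns_degree ?V ?A g h"
  let ?E = "dual_val s k :: (nat \<Rightarrow>\<^sub>0 nat) \<Rightarrow> 'a"
  assume "\<not> s * Suc k \<le> ?D"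
  then have D: "?D < s * Suc k" by simp
  have "(0::nat) < 2 ^ k" by simp
  with L have L0: "L > 0" by linarith
  have fin: "finite ?A" "finite ?V"
    using is_cnf_block_cnf[of s L] cnf_vars_block_cnf[OF s L0] by (auto simp: cnf_polys_def is_cnf_def)
  have degA: "total_degree (p * g p) \<le> ?D" if "p \<in> ?A" for p
    unfolding ns_degree_def using fin that by (intro Max_ge) auto
  have degV: "total_degree (h i * bool_axiom i) \<le> ?D" if "i \<in> ?V" for i
    unfolding ns_degree_def using fin that by (intro Max_ge) auto
  have start: "lin_ext ?E ((1 - mp_var y) * q) = 0"
    if "y \<in> block s 0" "total_degree ((1 - mp_var y) * q) \<le> ?D" for y q
  proof -
    have "lin_ext ?E (mp_monom 0 * (1 - mp_var y) * q) = 0"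
    proof (rule lin_ext_binomial_mult)
      show "total_degree (mp_monom 0 * (1 - mp_var y) * q) \<le> ?D" using that(2) by simp
    next
      fix m assume "mdeg (0 + m + Poly_Mapping.single y 1) \<le> ?D"
      then show "?E (0 + m + Poly_Mapping.single y 1) = ?E (0 + m)"
        using D s that(1) by (intro dual_val_plus_single) (auto simp: can_move_def mem_block_iff)
    qed
    then show ?thesis by simp
  qed
  \<comment> \<open>The factor for block \<open>t\<close> makes that block full, so a move on its
    successor is legal.\<close>
  have step: "lin_ext ?E (mp_monom (ind (block s t)) * (1 - mp_var y) * q) = 0"
    if "y \<in> block s (Suc t)" "total_degree (mp_monom (ind (block s t)) * (1 - mp_var y) * q) \<le> ?D"
    for t y q
    using that(2)
  proof (rule lin_ext_binomial_mult)
    fix m assume deg: "mdeg (ind (block s t) + m + Poly_Mapping.single y 1) \<le> ?D"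
    have "t \<in> full s (ind (block s t) + m)"
      by (simp add: full_def keys_plus_nat keys_ind)
    then show "?E (ind (block s t) + m + Poly_Mapping.single y 1) = ?E (ind (block s t) + m)"
      using D s that(1) deg
      by (intro dual_val_plus_single) (auto simp: can_move_def mem_block_iff)
  qed
  \<comment> \<open>Every multiple contains block \<open>L - 1\<close> completely, and a pebble
    there would force \<open>L < 2 ^ k\<close>. No degree bound enters here.\<close>
  have last: "lin_ext ?E (mp_monom (ind (block s (L - 1))) * q) = 0" for q
  proof -
    have "?E (ind (block s (L - 1)) + m) = 0" for m
    proof -
      have "L - 1 \<in> full s (ind (block s (L - 1)) + m)"
        by (simp add: full_def keys_plus_nat keys_ind)
      then show ?thesis
        using reach_less_power2[of k _ "L - 1"] L L0 by (fastforce simp: dual_val_def)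
    qed
    then show ?thesis unfolding lin_ext_monom_mult by (simp add: lin_ext_def)
  qed
  have "lin_ext ?E (p * g p) = 0" if p: "p \<in> ?A" for p
    using p degA[OF p] start step last unfolding cnf_polys_block_cnf by auto
  moreover have "lin_ext ?E (h i * bool_axiom i) = 0" if "i \<in> ?V" for i
  proof -
    let ?i = "Poly_Mapping.single i 1 :: nat \<Rightarrow>\<^sub>0 nat"
    \<comment> \<open>With the sign moved into the cofactor, this is the binomial shape with X equal
      to the variable itself. Raising the exponent of a variable already present leaves the full
      blocks unchanged.\<close>
    have eq: "h i * bool_axiom i = mp_monom ?i * (1 - mp_var i) * (- h i)"
      by (simp add: bool_axiom_def mp_var_def algebra_simps power2_eq_square)
    have "lin_ext ?E (mp_monom ?i * (1 - mp_var i) * (- h i)) = 0"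
    proof (rule lin_ext_binomial_mult)
      show "total_degree (mp_monom ?i * (1 - mp_var i) * (- h i)) \<le> ?D"
        using degV[OF that] eq by simp
    next
      fix m
      have "full s (?i + m + ?i) = full s (?i + m)" by (simp add: full_def keys_plus_nat insert_commute)
      then show "?E (?i + m + ?i) = ?E (?i + m)" by (simp add: dual_val_def)
    qed
    then show ?thesis using eq by simp
  qed
  ultimately have "lin_ext ?E ((\<Sum>p\<in>?A. p * g p) + (\<Sum>i\<in>?V. h i * bool_axiom i)) = 0"
    by (simp add: lin_ext_add lin_ext_sum)
  then have "?E 0 = 0" using ref by (simp add: ns_refutation_def)
  moreover have "full s 0 = {}" using s by (auto simp: full_def block_def)
  then have "?E 0 = 1" by (simp add: dual_val_def reach.empty)
  ultimately show False by simp
qed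

section \<open>The Monomial Calculus upper bound\<close>

text \<open>Forgetting the order of lines allows derivations to be built by induction. Linear
  combinations carry no degree test because they cannot exceed the degrees of their
  premises.\<close>

inductive mc_derives :: "nat set \<Rightarrow> 'a::field mpoly set \<Rightarrow> nat \<Rightarrow> 'a mpoly \<Rightarrow> bool" for V A D where
  ax: "p \<in> A \<Longrightarrow> total_degree p \<le> D \<Longrightarrow> mc_derives V A D p"
| lincomb: "mc_derives V A D p \<Longrightarrow> mc_derives V A D q \<Longrightarrow>
    mc_derives V A D (mp_const \<alpha> * p + mp_const \<beta> * q)"
| mult: "mc_derives V A D p \<Longrightarrow> mc_multipliable V A p \<Longrightarrow> i \<in> V \<Longrightarrow>
    total_degree (mp_var i * p) \<le> D \<Longrightarrow> mc_derives V A D (mp_var i * p)"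

text \<open>Premises are looked up in a set instead of by index, so concatenating derivations needs
  no renumbering.\<close>

definition mc_line :: "nat set \<Rightarrow> 'a::field mpoly set \<Rightarrow> 'a mpoly set \<Rightarrow> 'a mpoly \<Rightarrow> bool" where
  "mc_line V A Q p \<longleftrightarrow> p \<in> A \<or> p \<in> bool_axiom ` V
     \<or> (\<exists>q\<in>Q. \<exists>r\<in>Q. \<exists>\<alpha> \<beta>. p = mp_const \<alpha> * q + mp_const \<beta> * r)
     \<or> (\<exists>q\<in>Q. \<exists>i\<in>V. mc_multipliable V A q \<and> p = mp_var i * q)"

definition mc_valid :: "nat set \<Rightarrow> 'a::field mpoly set \<Rightarrow> 'a mpoly list \<Rightarrow> bool" where
  "mc_valid V A \<pi> \<longleftrightarrow> (\<forall>k<length \<pi>. mc_line V A (set (take k \<pi>)) (\<pi> ! k))"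

lemma mc_line_mono: "mc_line V A Q p \<Longrightarrow> Q \<subseteq> Q' \<Longrightarrow> mc_line V A Q' p"
  unfolding mc_line_def by blast

lemma mc_valid_append:
  assumes "mc_valid V A \<pi>" "mc_valid V A \<rho>"
  shows "mc_valid V A (\<pi> @ \<rho>)"
  unfolding mc_valid_def
proof (intro allI impI)
  fix k assume k: "k < length (\<pi> @ \<rho>)"
  show "mc_line V A (set (take k (\<pi> @ \<rho>))) ((\<pi> @ \<rho>) ! k)"
  proof (cases "k < length \<pi>")
    case True
    then show ?thesis using assms(1) by (simp add: mc_valid_def nth_append)
  next
    case False
    then have "mc_line V A (set (take (k - length \<pi>) \<rho>)) (\<rho> ! (k - length \<pi>))"
      using k assms(2) by (simp add: mc_valid_def)
    then show ?thesis using False by (auto simp: nth_append elim: mc_line_mono)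
  qed
qed

lemma mc_valid_snoc:
  assumes "mc_valid V A \<pi>" "mc_line V A (set \<pi>) p"
  shows "mc_valid V A (\<pi> @ [p])"
  using assms by (auto simp: mc_valid_def nth_append less_Suc_eq)

lemma mc_derives_imp_valid:
  assumes "mc_derives V A D p"
  shows "\<exists>\<pi>. mc_valid V A \<pi> \<and> \<pi> \<noteq> [] \<and> last \<pi> = p \<and> (\<forall>q\<in>set \<pi>. total_degree q \<le> D)"
  using assms
proof (induction rule: mc_derives.induct)
  case (ax p)
  then show ?case by (intro exI[of _ "[p]"]) (auto simp: mc_valid_def mc_line_def)
next
  case (lincomb p q \<alpha> \<beta>)
  then obtain \<pi> \<rho> where
    \<pi>: "mc_valid V A \<pi>" "\<pi> \<noteq> []" "last \<pi> = p" "\<forall>q\<in>set \<pi>. total_degree q \<le> D" and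
    \<rho>: "mc_valid V A \<rho>" "\<rho> \<noteq> []" "last \<rho> = q" "\<forall>q\<in>set \<rho>. total_degree q \<le> D" by blast
  have pq: "p \<in> set (\<pi> @ \<rho>)" "q \<in> set (\<pi> @ \<rho>)" using \<pi> \<rho> last_in_set by fastforce+
  then have "mc_line V A (set (\<pi> @ \<rho>)) (mp_const \<alpha> * p + mp_const \<beta> * q)"
    unfolding mc_line_def by blast
  moreover have "total_degree (mp_const \<alpha> * p + mp_const \<beta> * q) \<le> D"
    using pq \<pi>(4) \<rho>(4) by (intro total_degree_lincomb_le) auto
  moreover have "mc_valid V A (\<pi> @ \<rho>)" using \<pi>(1) \<rho>(1) by (rule mc_valid_append)
  ultimately show ?case using \<pi>(4) \<rho>(4)
    by (intro exI[of _ "(\<pi> @ \<rho>) @ [mp_const \<alpha> * p + mp_const \<beta> * q]"] conjI mc_valid_snoc)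
      auto
next
  case (mult p i)
  then obtain \<pi> where
    \<pi>: "mc_valid V A \<pi>" "\<pi> \<noteq> []" "last \<pi> = p" "\<forall>q\<in>set \<pi>. total_degree q \<le> D" by blast
  have "p \<in> set \<pi>" using \<pi> last_in_set by fastforce
  then have "mc_line V A (set \<pi>) (mp_var i * p)"
    unfolding mc_line_def using mult by blast
  then show ?case using \<pi> mult
    by (intro exI[of _ "\<pi> @ [mp_var i * p]"]) (auto intro!: mc_valid_snoc)
qed

lemma mc_refutation_of_derives:
  assumes "mc_derives V A D 1"
  shows "\<exists>\<pi>. mc_refutation V A \<pi> \<and> mc_degree \<pi> \<le> D"
proof -
  obtain \<pi> where \<pi>: "mc_valid V A \<pi>" "\<pi> \<noteq> []" "last \<pi> = 1" "\<forall>q\<in>set \<pi>. total_degree q \<le> D"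
    using mc_derives_imp_valid[OF assms] by blast
  have "mc_refutation V A \<pi>"
    unfolding mc_refutation_def
  proof (intro conjI allI impI)
    fix k assume k: "k < length \<pi>"
    have take: "\<exists>i<k. \<pi> ! i = q" if "q \<in> set (take k \<pi>)" for q
      using that k by (auto simp: in_set_conv_nth)
    have "mc_line V A (set (take k \<pi>)) (\<pi> ! k)" using \<pi>(1) k by (simp add: mc_valid_def)
    then show "\<pi> ! k \<in> A \<or> \<pi> ! k \<in> bool_axiom ` V \<or>
        (\<exists>i<k. \<exists>j<k. \<exists>\<alpha> \<beta>. \<pi> ! k = mp_const \<alpha> * \<pi> ! i + mp_const \<beta> * \<pi> ! j) \<or>
        (\<exists>j<k. \<exists>i\<in>V. mc_multipliable V A (\<pi> ! j) \<and> \<pi> ! k = mp_var i * \<pi> ! j)"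
      unfolding mc_line_def by (metis take)
  qed (use \<pi> in auto)
  moreover have "mc_degree \<pi> \<le> D" using \<pi> by (simp add: mc_degree_def)
  ultimately show ?thesis by blast
qed

section \<open>Deriving the product of one block from that of the next\<close>

lemma mc_derives_add:
  assumes "mc_derives V A D p" "mc_derives V A D q"
  shows "mc_derives V A D (p + q)"
  using mc_derives.lincomb[OF assms, of 1 1] by (simp add: mp_const_def)

lemma mc_derives_0:
  assumes "mc_derives V A D p"
  shows "mc_derives V A D 0"
  using mc_derives.lincomb[OF assms assms, of 0 0] by (simp add: mp_const_def)

text \<open>Variables are multiplied in one at a time. Starting from an axiom or a monomial, each
  intermediate product stays multipliable, and the bound over all subsets of \<open>C\<close>
  controls its degree.\<close>

lemma mc_derives_monom_mult:
  assumes "finite C" "C \<subseteq> V" "mc_derives V A D q" "q \<in> A \<or> (\<exists>m. q = mp_monom m)"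
    and "\<And>C'. C' \<subseteq> C \<Longrightarrow> total_degree (mp_monom (ind C') * q) \<le> D"
  shows "mc_derives V A D (mp_monom (ind C) * q)"
  using assms(1,2,5)
proof (induction C rule: finite_induct)
  case empty
  then show ?case using assms(3) by simp
next
  case (insert c C)
  have eq: "mp_monom (ind (insert c C)) * q = mp_var c * (mp_monom (ind C) * q)"
    using insert.hyps by (simp add: ind_insert mp_var_def mp_monom_mult flip: mult.assoc)
  show ?case
    unfolding eq
  proof (rule mc_derives.mult)
    show "mc_derives V A D (mp_monom (ind C) * q)"
      using insert.prems by (intro insert.IH) auto
    show "mc_multipliable V A (mp_monom (ind C) * q)"
      unfolding mc_multipliable_def using assms(4) by (auto simp: mp_monom_mult)
    show "total_degree (mp_var c * (mp_monom (ind C) * q)) \<le> D"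
      using insert.prems(2)[of "insert c C"] eq by simp
  qed (use insert.prems in auto)
qed

text \<open>Telescoping: the products of the monomial of \<open>C' \<subseteq> C\<close> with the axiom for
  \<open>c \<in> C\<close> sum up to the difference of the monomials of \<open>B\<close> and \<open>B \<union> C\<close>.\<close>

lemma mc_derives_block_step:
  fixes A :: "'a::field mpoly set"
  assumes fin: "finite B" "finite C" and disj: "B \<inter> C = {}" and V: "B \<subseteq> V" "C \<subseteq> V"
    and deg: "card B + card C \<le> D"
    and ax: "\<And>c. c \<in> C \<Longrightarrow> mp_monom (ind B) * (1 - mp_var c) \<in> A"
    and C: "mc_derives V A D (mp_monom (ind C))"
  shows "mc_derives V A D (mp_monom (ind B))"
proof -
  \<comment> \<open>Every monomial in the derivation is the product over some B' \<union> C', so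
    holding both blocks completely is the worst case.\<close>
  have degm: "total_degree (mp_monom (ind (B' \<union> C')) :: 'a mpoly) \<le> D"
    if "B' \<subseteq> B" "C' \<subseteq> C" for B' C'
  proof (rule total_degree_monom_le)
    have "card (B' \<union> C') \<le> card (B \<union> C)" using that fin by (intro card_mono) auto
    also have "\<dots> \<le> D" using deg card_Un_le[of B C] by linarith
    finally show "mdeg (ind (B' \<union> C')) \<le> D"
      using that fin by (simp add: mdeg_ind finite_subset)
  qed
  have expand: "mp_monom (ind C') * (mp_monom (ind B) * (1 - mp_var c)) =
      mp_monom (ind (B \<union> C')) - (mp_monom (ind (B \<union> insert c C')) :: 'a mpoly)"
    if "C' \<subseteq> C" "c \<in> C" "c \<notin> C'" for c C'
  proof -
    have "finite C'" "B \<inter> C' = {}" "c \<notin> B \<union> C'" using that fin disj finite_subset by auto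
    then show ?thesis using fin
      by (simp add: ind_insert ind_Un mp_var_def mp_monom_mult algebra_simps)
  qed
  have "C' \<subseteq> C \<Longrightarrow> mc_derives V A D (mp_monom (ind B) - mp_monom (ind (B \<union> C')))" for C'
  proof (induction C' rule: infinite_finite_induct)
    case (infinite C')
    then show ?case using fin finite_subset by blast
  next
    case empty
    show ?case using mc_derives_0[OF C] by simp
  next
    case (insert c C')
    then have c: "c \<in> C" "C' \<subseteq> C" by auto
    let ?q = "mp_monom (ind B) * (1 - mp_var c) :: 'a mpoly"
    have sub: "total_degree (mp_monom (ind C'') * ?q) \<le> D" if "C'' \<subseteq> C'" for C''
    proof -
      have "C'' \<subseteq> C" "c \<notin> C''" using that insert.hyps c by auto
      then show ?thesis
        using c degm[of B C''] degm[of B "insert c C''"]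
        by (subst expand) (auto intro: total_degree_diff_le)
    qed
    have "mc_derives V A D ?q"
      using ax[OF c(1)] sub[of "{}"] by (intro mc_derives.ax) auto
    then have "mc_derives V A D (mp_monom (ind C') * ?q)"
      by (rule mc_derives_monom_mult[rotated 2]) (use insert.hyps(1) sub ax[OF c(1)] V c in auto)
    then show ?case
      using mc_derives_add[OF insert.IH] c insert.hyps(2) by (fastforce simp: expand)
  qed
  then have "mc_derives V A D (mp_monom (ind B) - mp_monom (ind (B \<union> C)))" by simp
  \<comment> \<open>Adding the monomial of B \<union> C, obtained from that of \<open>C\<close>, to
    the telescoped difference leaves the monomial of \<open>B\<close>.\<close>
  moreover have "mc_derives V A D (mp_monom (ind B) * mp_monom (ind C))"
  proof (rule mc_derives_monom_mult)
    fix B' assume "B' \<subseteq> B"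
    then have "mp_monom (ind B') * mp_monom (ind C) = (mp_monom (ind (B' \<union> C)) :: 'a mpoly)"
      using fin disj by (subst ind_Un) (auto simp: mp_monom_mult finite_subset)
    then show "total_degree (mp_monom (ind B') * mp_monom (ind C) :: 'a mpoly) \<le> D"
      using degm[of B' C] \<open>B' \<subseteq> B\<close> by simp
  qed (use fin V C in auto)
  moreover have "mp_monom (ind B) * mp_monom (ind C) = (mp_monom (ind (B \<union> C)) :: 'a mpoly)"
    using fin disj by (simp add: ind_Un mp_monom_mult)
  ultimately show ?thesis using mc_derives_add by fastforce
qed

lemma mc_refutation_block_cnf:
  assumes s: "s > 0" and L: "L > 0"
  shows "\<exists>\<pi> :: 'a::field mpoly list.
    mc_refutation (cnf_vars (block_cnf s L)) (cnf_polys (block_cnf s L)) \<pi> \<and> mc_degree \<pi> \<le> 2 * s"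
proof (rule mc_refutation_of_derives)
  let ?V = "cnf_vars (block_cnf s L)"
  let ?A = "cnf_polys (block_cnf s L) :: 'a mpoly set"
  have V: "block s t \<subseteq> ?V" if "t < L" for t
    using that s L by (auto simp: cnf_vars_block_cnf mem_block_iff div_less_iff_less_mult mult.commute)
  \<comment> \<open>Induction on the distance from the last block, because the derivation runs
    backwards along the path from the closing clause.\<close>
  have "t < L \<Longrightarrow> mc_derives ?V ?A (2 * s) (mp_monom (ind (block s (L - 1 - t))))" for t
  proof (induction t)
    case 0
    show ?case
      by (rule mc_derives.ax)
        (auto simp: cnf_polys_block_cnf mdeg_ind intro!: total_degree_monom_le)
  next
    case (Suc t)
    define r where "r = L - 1 - Suc t"
    have r: "L - 1 - t = Suc r" "Suc r < L" using Suc.prems by (auto simp: r_def)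
    have "mc_derives ?V ?A (2 * s) (mp_monom (ind (block s r)))"
    proof (rule mc_derives_block_step)
      show "mc_derives ?V ?A (2 * s) (mp_monom (ind (block s (Suc r))))" using Suc r by simp
      show "block s r \<inter> block s (Suc r) = {}" using s by (auto simp: mem_block_iff)
      show "mp_monom (ind (block s r)) * (1 - mp_var c) \<in> ?A" if "c \<in> block s (Suc r)" for c
        using that r by (auto simp: cnf_polys_block_cnf)
    qed (use V r in auto)
    then show ?case by (simp add: r_def)
  qed
  from this[of "L - 1"] have "mc_derives ?V ?A (2 * s) (mp_monom (ind (block s 0)))"
    using L by simp
  \<comment> \<open>The unit clauses on block 0 act as a block step with empty premise block, whose
    monomial is 1.\<close>
  then have "mc_derives ?V ?A (2 * s) (mp_monom (ind {}))"
    by (rule mc_derives_block_step[rotated -1])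
      (use V[of 0] L in \<open>auto simp: cnf_polys_block_cnf\<close>)
  then show "mc_derives ?V ?A (2 * s) 1" by simp
qed

section \<open>The separation\<close>

text \<open>This is the claim for a single \<open>n\<close>, with the logarithm kept in the integer
  form n \<le> s * 2 ^ K. Parameters outside 0 < s \<le> n get a formula refuted in degree 0 and the
  trivial bound \<open>e = 0\<close>.\<close>

lemma separating_cnf_exists:
  fixes s n :: nat
  shows "\<exists>F d e. is_cnf F \<and> unsatisfiable F \<and> card (cnf_vars F) \<le> n \<and> n \<le> 2 * card (cnf_vars F) \<and>
    d \<le> 2 * s \<and>
    (\<exists>\<pi> :: 'a::field mpoly list. mc_refutation (cnf_vars F) (cnf_polys F) \<pi> \<and> mc_degree \<pi> = d) \<and>
    (\<forall>(g :: 'a mpoly \<Rightarrow> 'a mpoly) h. ns_refutation (cnf_vars F) (cnf_polys F) g h \<longrightarrow>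
      e \<le> ns_degree (cnf_vars F) (cnf_polys F) g h) \<and>
    (0 < s \<and> s \<le> n \<longrightarrow> (\<exists>K. e = s * K \<and> n \<le> s * 2 ^ K))"
proof (cases "0 < s \<and> s \<le> n")
  case False
  txt \<open>If \<open>s = 0\<close>, the refutation must have degree 0, so the empty clause is included; the
    other clause only supplies the variables.\<close>
  define F :: cnf where "F = {({}, {}), ({..<n}, {})}"
  have "(1 :: 'a mpoly) \<in> cnf_polys F" by (simp add: F_def cnf_polys_def clause_poly_def)
  then have "mc_refutation (cnf_vars F) (cnf_polys F) [1 :: 'a mpoly]"
    by (simp add: mc_refutation_def)
  moreover have "mc_degree [1 :: 'a mpoly] = 0" by (simp add: mc_degree_def)
  moreover have "is_cnf F" by (simp add: F_def is_cnf_def)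
  moreover have "unsatisfiable F" by (simp add: F_def unsatisfiable_def satisfies_clause_def)
  moreover have "cnf_vars F = {..<n}" by (simp add: F_def cnf_vars_def)
  ultimately show ?thesis using False
    by - (rule exI[of _ F], rule exI[of _ 0], rule exI[of _ 0], auto)
next
  case True
  define L where "L = n div s"
  have L: "L > 0" using True by (simp add: L_def div_greater_zero_iff)
  \<comment> \<open>The largest \<open>k\<close> for which the pebbling bound keeps the end of the
    path out of reach.\<close>
  obtain k where k: "2 ^ k \<le> L" "L < 2 ^ Suc k"
    using ex_power_ivl1[of 2 L] L by auto
  obtain \<pi> :: "'a mpoly list" where \<pi>:
    "mc_refutation (cnf_vars (block_cnf s L)) (cnf_polys (block_cnf s L)) \<pi>" "mc_degree \<pi> \<le> 2 * s"
    using mc_refutation_block_cnf True L by blast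
  have card: "card (cnf_vars (block_cnf s L)) = s * L"
    using True L by (simp add: cnf_vars_block_cnf)
  \<comment> \<open>Rounding \<open>n\<close> down to whole blocks loses less than one block; as
    there is at least one block, this is at most a factor of 2.\<close>
  have n: "n < s * L + s"
    using True dividend_less_times_div[of s n] by (simp add: L_def)
  have "s \<le> s * L" using L by simp
  with n have n2: "n \<le> 2 * (s * L)" by linarith
  have K: "\<exists>K. s * Suc k = s * K \<and> n \<le> s * 2 ^ K"
  proof (intro exI conjI)
    show "n \<le> s * 2 ^ Suc k"
    proof -
      have "s * L + s = s * Suc L" by simp
      also have "\<dots> \<le> s * 2 ^ Suc k" using k(2) by (intro mult_le_mono2) simp
      finally show ?thesis using n by linarith
    qed
  qed simp
  have "s * L \<le> n" by (simp add: L_def)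
  then show ?thesis
    using \<pi> n2 K card ns_degree_block_cnf[of s k L] k(1) True is_cnf_block_cnf unsatisfiable_block_cnf
    by - (rule exI[of _ "block_cnf s L"], rule exI[of _ "mc_degree \<pi>"], rule exI[of _ "s * Suc k"],
      auto simp del: mult_Suc_right)
qed

theorem theorem3p10:
  fixes s :: "nat \<Rightarrow> nat" and \<epsilon> :: real
  assumes "0 < \<epsilon>" and "\<epsilon> < 1 / 2"
    and "(\<lambda>n. real (s n)) \<in> O(\<lambda>n. real n powr (1 / 2 - \<epsilon>))"
  shows "\<exists>F :: nat \<Rightarrow> cnf.
    (\<forall>n. is_cnf (F n) \<and> unsatisfiable (F n)) \<and>
    (\<lambda>n. real (card (cnf_vars (F n)))) \<in> \<Theta>(\<lambda>n. real n) \<and>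
    (\<exists>d :: nat \<Rightarrow> nat. (\<lambda>n. real (d n)) \<in> O(\<lambda>n. real (s n)) \<and>
       (\<forall>n. \<exists>\<pi> :: 'a::field mpoly list.
          mc_refutation (cnf_vars (F n)) (cnf_polys (F n)) \<pi> \<and> mc_degree \<pi> = d n)) \<and>
    (\<exists>e :: nat \<Rightarrow> nat. (\<lambda>n. real (e n)) \<in> \<Omega>(\<lambda>n. real (s n) * ln (real n)) \<and>
       (\<forall>n (g :: 'a mpoly \<Rightarrow> 'a mpoly) h.
          ns_refutation (cnf_vars (F n)) (cnf_polys (F n)) g h \<longrightarrow>
          e n \<le> ns_degree (cnf_vars (F n)) (cnf_polys (F n)) g h))"
proof -
  \<comment> \<open>Bundling the properties lets the formula and both degree bounds be chosen
    together for each \<open>n\<close>.\<close>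
  define Q where "Q n F d e \<longleftrightarrow> is_cnf F \<and> unsatisfiable F \<and>
      card (cnf_vars F) \<le> n \<and> n \<le> 2 * card (cnf_vars F) \<and> d \<le> 2 * s n \<and>
      (\<exists>\<pi> :: 'a mpoly list. mc_refutation (cnf_vars F) (cnf_polys F) \<pi> \<and> mc_degree \<pi> = d) \<and>
      (\<forall>(g :: 'a mpoly \<Rightarrow> 'a mpoly) h. ns_refutation (cnf_vars F) (cnf_polys F) g h \<longrightarrow>
        e \<le> ns_degree (cnf_vars F) (cnf_polys F) g h) \<and>
      (0 < s n \<and> s n \<le> n \<longrightarrow> (\<exists>K. e = s n * K \<and> n \<le> s n * 2 ^ K))" for n F d e
  have "\<forall>n. \<exists>F d e. Q n F d e"
    unfolding Q_def by (intro allI separating_cnf_exists)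
  then obtain F d e where Q: "\<And>n. Q n (F n) (d n) (e n)" by metis
  note Fde = Q[unfolded Q_def]
  have vars: "(\<lambda>n. real (card (cnf_vars (F n)))) \<in> \<Theta>(\<lambda>n. real n)"
  proof (intro bigthetaI bigoI[of _ 1] landau_omega.bigI[of "1/2"] always_eventually allI)
    fix n
    have "n \<le> 2 * card (cnf_vars (F n))" using Fde by blast
    then show "norm (real (card (cnf_vars (F n)))) \<ge> 1 / 2 * norm (real n)" by simp
  qed (use Fde in auto)
  have d: "(\<lambda>n. real (d n)) \<in> O(\<lambda>n. real (s n))"
  proof (intro bigoI[of _ 2] always_eventually allI)
    fix n
    have "d n \<le> 2 * s n" using Fde by blast
    then show "norm (real (d n)) \<le> 2 * norm (real (s n))" by simp
  qed
  have e: "(\<lambda>n. real (e n)) \<in> \<Omega>(\<lambda>n. real (s n) * ln (real n))"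
  proof (rule landau_omega.bigI[of "1/2"])
    \<comment> \<open>The growth hypothesis enters only through s n \<le> sqrt n for large
      \<open>n\<close>.\<close>
    have "(\<lambda>n. real n powr (1 / 2 - \<epsilon>)) \<in> o(\<lambda>n. real n powr (1 / 2))"
      using assms(1) by (intro powr_smallo_iff[THEN iffD2] filterlim_real_sequentially) auto
    with assms(3) have "(\<lambda>n. real (s n)) \<in> o(\<lambda>n. real n powr (1 / 2))"
      by (rule landau_o.big_small_trans)
    then have "\<forall>\<^sub>F n in sequentially. norm (real (s n)) \<le> 1 * norm (real n powr (1 / 2))"
      by (rule landau_o.smallD) simp
    then show "\<forall>\<^sub>F n in sequentially. norm (real (e n)) \<ge> 1 / 2 * norm (real (s n) * ln (real n))"
      using eventually_gt_at_top[of 0]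
    proof eventually_elim
      case (elim n)
      then have sq: "real (s n) \<le> sqrt (real n)" by (simp add: powr_half_sqrt)
      also have "\<dots> \<le> real n" using elim(2) by (simp add: real_le_lsqrt power2_eq_square)
      finally have "s n \<le> n" by simp
      then consider "s n = 0" | K where "e n = s n * K" "n \<le> s n * 2 ^ K" using Fde[of n] by blast
      then show ?case
      proof cases
        case 2
        \<comment> \<open>Since \<open>s n\<close> is at most sqrt n, n \<le> s n * 2 ^ K yields
          sqrt n \<le> 2 ^ K. Taking logarithms and using ln 2 < 1 gives K \<ge> ln n / 2, the
          source of the constant 1/2.\<close>
        have "sqrt n * sqrt n = real n" by simp
        also have "\<dots> \<le> real (s n * 2 ^ K)" using 2(2) by (simp only: of_nat_le_iff)
        also have "\<dots> \<le> sqrt n * 2 ^ K" using sq by (simp add: mult_right_mono)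
        finally have "sqrt n \<le> 2 ^ K" using elim(2) by (subst (asm) mult_le_cancel_left_pos) auto
        then have "ln (sqrt n) \<le> ln (2 ^ K)" using elim(2) by (subst ln_le_cancel_iff) auto
        then have "ln (real n) / 2 \<le> K * ln 2" using elim(2) by (simp add: ln_sqrt ln_realpow)
        also have "\<dots> \<le> real K * 1" using ln_2_less_1 by (intro mult_left_mono) auto
        finally have "real (s n) * (ln (real n) / 2) \<le> real (s n) * K" by (intro mult_left_mono) auto
        moreover have "ln (real n) \<ge> 0" using elim(2) by simp
        ultimately show ?thesis using 2(1) by (simp add: abs_mult)
      qed simp
    qed
  qed simp
  show ?thesis
  proof (intro exI[of _ F] conjI)
    show "\<exists>d. (\<lambda>n. real (d n)) \<in> O(\<lambda>n. real (s n)) \<and>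
       (\<forall>n. \<exists>\<pi> :: 'a mpoly list.
          mc_refutation (cnf_vars (F n)) (cnf_polys (F n)) \<pi> \<and> mc_degree \<pi> = d n)"
      using Fde d by (intro exI[of _ d]) simp
    show "\<exists>e. (\<lambda>n. real (e n)) \<in> \<Omega>(\<lambda>n. real (s n) * ln (real n)) \<and>
       (\<forall>n (g :: 'a mpoly \<Rightarrow> 'a mpoly) h.
          ns_refutation (cnf_vars (F n)) (cnf_polys (F n)) g h \<longrightarrow>
          e n \<le> ns_degree (cnf_vars (F n)) (cnf_polys (F n)) g h)"
      using Fde e by (intro exI[of _ e]) simp
  qed (use Fde vars in simp_all)
qed

end
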